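(* Let $(\mathfrak g,\varphi_i,\xi_i,\eta_i)$, $i=1,2,3$, be an almost $3$-contact Lie algebra with abelian structure. Then every almost contact structure in the sphere $\Sigma_{\mathfrak g}=\{(\varphi_a,\xi_a,\eta_a)\mid a\in S^2\}$ is abelian, where for $a=(a_1,a_2,a_3)\in S^2$ one sets $\varphi_a=\sum_ia_i\varphi_i$, $\xi_a=\sum_ia_i\xi_i$, $\eta_a=\sum_ia_i\eta_i$.
   Context: An almost contact structure on a real Lie algebra $\mathfrak g$ is a triple $(\varphi,\xi,\eta)$, $\varphi\in\mathrm{End}(\mathfrak g)$, $\xi\in\mathfrak g$, $\eta\in\mathfrak g^*$, with $\varphi^2=-I+\eta\otimes\xi$ and $\eta(\xi)=1$. It is abelian if $\mathrm{ad}_\xi\circ\varphi=\varphi\circ\mathrm{ad}_\xi$ and $[\varphi X,\varphi Y]=[X,Y]$ for all $X,Y\in\operatorname{Ker}\eta$. An almost $3$-contact Lie algebra is a real Lie algebra $\mathfrak g$ of dimension $4n+3$ with three almost contact structures $(\varphi_i,\xi_i,\eta_i)$, $i=1,2,3$, such that for every even permutation $(i,j,k)$ of $(1,2,3)$: $\varphi_k=\varphi_i\varphi_j-\eta_j\otimes\xi_i=-\varphi_j\varphi_i+\eta_i\otimes\xi_j$, $\xi_k=\varphi_i\xi_j=-\varphi_j\xi_i$, $\eta_k=\eta_i\circ\varphi_j=-\eta_j\circ\varphi_i$. The structure is abelian if each of the three structures $(\varphi_i,\xi_i,\eta_i)$ is abelian. $S^2$ is the unit sphere in $\mathbb R^3$;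 each $(\varphi_a,\xi_a,\eta_a)$, $a\in S^2$, is an almost contact structure on $\mathfrak g$. *)

theory Defs
  imports "HOL-Analysis.Analysis"
begin

definition real_lie_algebra :: "('a::real_vector \<Rightarrow> 'a \<Rightarrow> 'a) \<Rightarrow> bool" where
  "real_lie_algebra br \<longleftrightarrow>
     bilinear br \<and>
     (\<forall>X. br X X = 0) \<and>
     (\<forall>X Y Z. br X (br Y Z) + br Y (br Z X) + br Z (br X Y) = 0)"

definition almost_contact ::
    "('a::real_vector \<Rightarrow> 'a) \<Rightarrow> 'a \<Rightarrow> ('a \<Rightarrow> real) \<Rightarrow> bool" where
  "almost_contact \<phi> \<xi> \<eta> \<longleftrightarrow>
     linear \<phi> \<and> linear \<eta> \<and>
     \<phi> \<circ> \<phi> = (\<lambda>X. - X + \<eta> X *\<^sub>R \<xi>) \<and>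
     \<eta> \<xi> = 1"

(* br \<xi> is the adjoint map ad_\<xi>. *)
definition abelian_almost_contact ::
    "('a::real_vector \<Rightarrow> 'a \<Rightarrow> 'a) \<Rightarrow> ('a \<Rightarrow> 'a) \<Rightarrow> 'a \<Rightarrow> ('a \<Rightarrow> real) \<Rightarrow> bool" where
  "abelian_almost_contact br \<phi> \<xi> \<eta> \<longleftrightarrow>
     br \<xi> \<circ> \<phi> = \<phi> \<circ> br \<xi> \<and>
     (\<forall>X Y. \<eta> X = 0 \<longrightarrow> \<eta> Y = 0 \<longrightarrow> br (\<phi> X) (\<phi> Y) = br X Y)"

(* The indices 1, 2, 3 are the elements of the numeral type 3 (in which 3 = 0), so an even
   permutation (i, j, k) of (1, 2, 3) is (p 1, p 2, p 3) for an even permutation p of that type.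
   The dimension 4n + 3 is nonzero, hence the condition on dim forces finite dimension:
   dim is 0 on infinite-dimensional spaces. *)
definition almost_3_contact_lie_algebra ::
    "('a::real_vector \<Rightarrow> 'a \<Rightarrow> 'a) \<Rightarrow> (3 \<Rightarrow> 'a \<Rightarrow> 'a) \<Rightarrow> (3 \<Rightarrow> 'a) \<Rightarrow> (3 \<Rightarrow> 'a \<Rightarrow> real) \<Rightarrow> bool"
  where
  "almost_3_contact_lie_algebra br \<phi> \<xi> \<eta> \<longleftrightarrow>
     real_lie_algebra br \<and>
     (\<exists>n. dim (UNIV :: 'a set) = 4 * n + 3) \<and>
     (\<forall>i. almost_contact (\<phi> i) (\<xi> i) (\<eta> i)) \<and>
     (\<forall>p. p permutes (UNIV :: 3 set) \<and> evenperm p \<longrightarrow>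
        (let i = p 1; j = p 2; k = p 3 in
          \<phi> k = (\<lambda>X. \<phi> i (\<phi> j X) - \<eta> j X *\<^sub>R \<xi> i) \<and>
          \<phi> k = (\<lambda>X. - \<phi> j (\<phi> i X) + \<eta> i X *\<^sub>R \<xi> j) \<and>
          \<xi> k = \<phi> i (\<xi> j) \<and> \<xi> k = - \<phi> j (\<xi> i) \<and>
          \<eta> k = \<eta> i \<circ> \<phi> j \<and> \<eta> k = (\<lambda>X. - \<eta> j (\<phi> i X))))"

definition abelian_3_contact ::
    "('a::real_vector \<Rightarrow> 'a \<Rightarrow> 'a) \<Rightarrow> (3 \<Rightarrow> 'a \<Rightarrow> 'a) \<Rightarrow> (3 \<Rightarrow> 'a) \<Rightarrow> (3 \<Rightarrow> 'a \<Rightarrow> real) \<Rightarrow> bool"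
  where
  "abelian_3_contact br \<phi> \<xi> \<eta> \<longleftrightarrow> (\<forall>i. abelian_almost_contact br (\<phi> i) (\<xi> i) (\<eta> i))"

definition contact_sphere ::
    "(3 \<Rightarrow> 'a::real_vector \<Rightarrow> 'a) \<Rightarrow> (3 \<Rightarrow> 'a) \<Rightarrow> (3 \<Rightarrow> 'a \<Rightarrow> real) \<Rightarrow>
     (('a \<Rightarrow> 'a) \<times> 'a \<times> ('a \<Rightarrow> real)) set" where
  "contact_sphere \<phi> \<xi> \<eta> =
     {(\<lambda>X. \<Sum>i\<in>UNIV. a $ i *\<^sub>R \<phi> i X, \<Sum>i\<in>UNIV. a $ i *\<^sub>R \<xi> i, \<lambda>X. \<Sum>i\<in>UNIV. a $ i * \<eta> i X) | a.
        a \<in> sphere (0 :: real ^ 3) 1}"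

end

theory Submission
  imports Defs
begin

text \<open>
  Writing \<open>A\<^sub>i = ad \<xi>\<^sub>i\<close>, abelianness of the \<open>i\<close>-th structure is equivalent to
  \<open>[\<phi>\<^sub>i X, Y] + [X, \<phi>\<^sub>i Y] = \<eta>\<^sub>i(X) A\<^sub>i \<phi>\<^sub>i Y - \<eta>\<^sub>i(Y) A\<^sub>i \<phi>\<^sub>i X\<close> together with \<open>A\<^sub>i \<phi>\<^sub>i = \<phi>\<^sub>i A\<^sub>i\<close>.
  Inserting Reeb vectors shows, for \<open>(i, j, k)\<close> cyclic, that \<open>A\<^sub>i \<phi>\<^sub>j\<close> equals \<open>A\<^sub>k\<close> up to the correction
  \<open>\<eta>\<^sub>j \<otimes> [\<xi>\<^sub>j, \<xi>\<^sub>k]\<close>. The conditions for the structure at \<open>a \<in> S\<^sup>2\<close> are quadratic in \<open>a\<close>; their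
  diagonal terms are the given conditions, and their polarised off-diagonal terms follow from
  these relations and from \<open>\<phi>\<^sub>1 [\<xi>\<^sub>2, \<xi>\<^sub>3] = \<phi>\<^sub>2 [\<xi>\<^sub>3, \<xi>\<^sub>1] = \<phi>\<^sub>3 [\<xi>\<^sub>1, \<xi>\<^sub>2]\<close>.
\<close>

section \<open>Indices modulo 3 and quadratic sums over the sphere\<close>

lemma evenperm_rotate_3:
  fixes i :: 3
  shows "\<exists>p. p permutes (UNIV :: 3 set) \<and> evenperm p \<and> p 1 = i \<and> p 2 = i + 1 \<and> p 3 = i + 2"
proof -
  \<comment> \<open>This is the 3-cycle; its powers \<open>id\<close>, \<open>r\<close> and
    \<open>r \<circ> r\<close> realise the three possible values of \<open>i\<close>.\<close>
  define r :: "3 \<Rightarrow> 3" where "r = Transposition.transpose 1 2 \<circ> Transposition.transpose 2 3"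
  have r: "r permutes UNIV" "evenperm r" "permutation r"
    unfolding r_def
    by (auto simp: evenperm_comp evenperm_swap permutation_compose permutation_swap_id
        intro!: permutes_compose permutes_swap_id)
  have r_vals: "r 1 = 2" "r 2 = 3" "r 3 = 1"
    by (simp_all add: r_def Transposition.transpose_def)
  consider "i = 1" | "i = 2" | "i = 3"
    using exhaust_3 by blast
  then show ?thesis
  proof cases
    case 1
    then show ?thesis
      by (intro exI[of _ id]) (auto simp: permutes_id evenperm_id)
  next
    case 2
    with r r_vals show ?thesis by (intro exI[of _ r]) auto
  next
    case 3
    with r r_vals show ?thesis
      by (intro exI[of _ "r \<circ> r"]) (auto simp: permutes_compose evenperm_comp)
  qed
qed

text \<open>Two distinct residues modulo 3 differ by 1 in one order or the other. Each polarised
  identity is thereby reduced to the diagonal and one cyclic case.\<close>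

lemma symmetric_rel_3:
  fixes P :: "3 \<Rightarrow> 3 \<Rightarrow> bool"
  assumes "\<And>i. P i i" "\<And>i. P i (i + 1)" "\<And>i j. P i j \<Longrightarrow> P j i"
  shows "P i j"
proof -
  have "(1 :: 3) + 1 = 2" "(2 :: 3) + 1 = 3" "(3 :: 3) + 1 = 1"
    by simp_all
  then have "P 1 2" "P 2 3" "P 3 1"
    using assms(2) by metis+
  then show ?thesis
    using assms(1,3) exhaust_3[of i] exhaust_3[of j] by metis
qed

text \<open>The weights \<open>a i * a j\<close> are symmetric, so the sum sees only the symmetric
  part of its coefficients. Doubling both sides avoids splitting into diagonal and off-diagonal
  terms.\<close>

lemma quadratic_sum_eqI:
  fixes S T :: "'i::finite \<Rightarrow> 'i \<Rightarrow> 'a::real_vector" and a :: "'i \<Rightarrow> real"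
  assumes "\<And>i j. S i j + S j i = T i j + T j i"
  shows "(\<Sum>i\<in>UNIV. \<Sum>j\<in>UNIV. (a i * a j) *\<^sub>R S i j) = (\<Sum>i\<in>UNIV. \<Sum>j\<in>UNIV. (a i * a j) *\<^sub>R T i j)"
proof -
  have sym: "2 *\<^sub>R (\<Sum>i\<in>UNIV. \<Sum>j\<in>UNIV. (a i * a j) *\<^sub>R R i j)
      = (\<Sum>i\<in>UNIV. \<Sum>j\<in>UNIV. (a i * a j) *\<^sub>R (R i j + R j i))" for R :: "'i \<Rightarrow> 'i \<Rightarrow> 'a"
  proof -
    have "(\<Sum>i\<in>UNIV. \<Sum>j\<in>UNIV. (a i * a j) *\<^sub>R R j i) = (\<Sum>i\<in>UNIV. \<Sum>j\<in>UNIV. (a i * a j) *\<^sub>R R i j)"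
      by (subst sum.swap) (simp add: mult.commute)
    then show ?thesis
      by (simp add: scaleR_right_distrib sum.distrib scaleR_2)
  qed
  have "2 *\<^sub>R (\<Sum>i\<in>UNIV. \<Sum>j\<in>UNIV. (a i * a j) *\<^sub>R S i j)
      = 2 *\<^sub>R (\<Sum>i\<in>UNIV. \<Sum>j\<in>UNIV. (a i * a j) *\<^sub>R T i j)"
    unfolding sym assms ..
  then show ?thesis by simp
qed

text \<open>The diagonal contributes the squared norm of \<open>a\<close>; this is where the unit
  length of \<open>a\<close> enters.\<close>

lemma sum_sphere_delta:
  fixes a :: "real ^ 'n" and v :: "'a::real_vector"
  assumes "a \<in> sphere 0 1"
  shows "(\<Sum>i\<in>UNIV. \<Sum>j\<in>UNIV. (a $ i * a $ j) *\<^sub>R (if i = j then v else 0)) = v"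
proof -
  have "(\<Sum>i\<in>UNIV. a $ i * a $ i) = 1"
    using assms by (simp add: norm_eq_1 inner_vec_def)
  then show ?thesis
    by (simp add: if_distrib[of "scaleR _"] scaleR_left.sum[symmetric] cong: if_cong)
qed

section \<open>A single almost contact structure\<close>

lemma almost_contact_square:
  assumes "almost_contact f x h"
  shows "f (f X) = - X + h X *\<^sub>R x"
  using assms unfolding almost_contact_def by (metis comp_apply)

text \<open>First \<open>f x\<close> is a multiple of \<open>x\<close>, and
  \<open>f (f x) = 0\<close> then forces \<open>f x = 0\<close>. Computing
  \<open>f (f (f X))\<close> in two ways leaves \<open>h (f X) *\<^sub>R x = 0\<close> with
  \<open>x\<close> nonzero.\<close>

lemma almost_contact_form_apply_eq_0:
  assumes "almost_contact f x h"
  shows "h (f X) = 0"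
proof -
  have lin: "linear f" and hx: "h x = 1"
    using assms by (auto simp: almost_contact_def)
  have sq: "f (f X) = - X + h X *\<^sub>R x" for X
    using assms by (rule almost_contact_square)
  have f0: "f (f x) = 0"
    by (simp add: sq hx)
  have "- f x + h (f x) *\<^sub>R x = 0"
    using sq[of "f x"] by (simp add: f0 linear_0[OF lin])
  then have fx: "f x = h (f x) *\<^sub>R x"
    by (simp add: add_eq_0_iff)
  then have "f (f x) = h (f x) *\<^sub>R f x"
    by (metis linear_scale[OF lin])
  then have "f x = 0"
    using f0 fx by (metis scaleR_eq_0_iff)
  then have "f (f (f X)) = - f X"
    by (simp add: sq[of X] linear_diff[OF lin] linear_scale[OF lin])
  then have "h (f X) *\<^sub>R x = 0"
    using sq[of "f X"] by simp
  moreover have "x \<noteq> 0"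
    using assms hx by (auto simp: almost_contact_def linear_0)
  ultimately show ?thesis by simp
qed

text \<open>Addition is modulo 3, so these triples are exactly the even permutations of (1, 2,
  3).\<close>

definition cyclic :: "3 \<Rightarrow> 3 \<Rightarrow> 3 \<Rightarrow> bool" where
  "cyclic i j k \<longleftrightarrow> j = i + 1 \<and> k = i + 2"

lemma cyclic_rotate: "cyclic i j k \<Longrightarrow> cyclic j k i"
  by (simp add: cyclic_def)

section \<open>Algebraic identities of the three structures\<close>

locale abelian_3_contact_lie_algebra =
  fixes br :: "'a::real_vector \<Rightarrow> 'a \<Rightarrow> 'a"
    and \<phi> :: "3 \<Rightarrow> 'a \<Rightarrow> 'a" and \<xi> :: "3 \<Rightarrow> 'a" and \<eta> :: "3 \<Rightarrow> 'a \<Rightarrow> real"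
  assumes contact: "almost_3_contact_lie_algebra br \<phi> \<xi> \<eta>"
    and abelian: "abelian_3_contact br \<phi> \<xi> \<eta>"
begin

lemma bilinear_br: "bilinear br"
  and br_self [simp]: "br X X = 0"
  using contact by (auto simp: almost_3_contact_lie_algebra_def real_lie_algebra_def)

lemmas br_linear [simp] =
  bilinear_ladd[OF bilinear_br] bilinear_radd[OF bilinear_br]
  bilinear_lmul[OF bilinear_br] bilinear_rmul[OF bilinear_br]
  bilinear_lneg[OF bilinear_br] bilinear_rneg[OF bilinear_br]
  bilinear_lsub[OF bilinear_br] bilinear_rsub[OF bilinear_br]
  bilinear_lzero[OF bilinear_br] bilinear_rzero[OF bilinear_br]

lemma br_skew: "br X Y = - br Y X"
proof -
  have "br (X + Y) (X + Y) = 0" by (rule br_self)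
  then have "br X Y + br Y X = 0" by (simp del: br_self add: br_self[of X] br_self[of Y] add.commute)
  then show ?thesis by (simp add: eq_neg_iff_add_eq_0)
qed

lemma contact_each: "almost_contact (\<phi> i) (\<xi> i) (\<eta> i)"
  using contact by (auto simp: almost_3_contact_lie_algebra_def)

lemma linear_phi: "linear (\<phi> i)" and linear_eta: "linear (\<eta> i)"
  and eta_xi_self [simp]: "\<eta> i (\<xi> i) = 1"
  using contact_each[of i] by (auto simp: almost_contact_def)

lemmas phi_linear [simp] =
  linear_add[OF linear_phi] linear_scale[OF linear_phi] linear_neg[OF linear_phi]
  linear_diff[OF linear_phi] linear_0[OF linear_phi]

lemmas eta_linear [simp] =
  linear_add[OF linear_eta] linear_scale[OF linear_eta] linear_neg[OF linear_eta]
  linear_diff[OF linear_eta] linear_0[OF linear_eta]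

lemma phi_square: "\<phi> i (\<phi> i X) = - X + \<eta> i X *\<^sub>R \<xi> i"
  using contact_each by (rule almost_contact_square)

lemma eta_phi_self [simp]: "\<eta> i (\<phi> i X) = 0"
  using contact_each by (rule almost_contact_form_apply_eq_0)

lemma phi_xi_self [simp]: "\<phi> i (\<xi> i) = 0"
proof -
  have "\<phi> i (\<phi> i (\<phi> i (\<xi> i))) = - \<phi> i (\<xi> i)"
    by (subst phi_square) simp
  then show ?thesis
    using phi_square[of i "\<xi> i"] by simp
qed

context
  fixes i j k
  assumes cyc: "cyclic i j k"
begin

lemma phi_phi: "\<phi> i (\<phi> j X) = \<phi> k X + \<eta> j X *\<^sub>R \<xi> i"
  and phi_phi': "\<phi> j (\<phi> i X) = - \<phi> k X + \<eta> i X *\<^sub>R \<xi> j"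
  and phi_xi: "\<phi> i (\<xi> j) = \<xi> k"
  and phi_xi': "\<phi> j (\<xi> i) = - \<xi> k"
  and eta_phi: "\<eta> i (\<phi> j X) = \<eta> k X"
  and eta_phi': "\<eta> j (\<phi> i X) = - \<eta> k X"
proof -
  obtain p where p: "p permutes (UNIV :: 3 set)" "evenperm p" "p 1 = i" "p 2 = j" "p 3 = k"
    using evenperm_rotate_3[of i] cyc by (auto simp: cyclic_def)
  then have *: "\<phi> k = (\<lambda>X. \<phi> i (\<phi> j X) - \<eta> j X *\<^sub>R \<xi> i)"
    "\<phi> k = (\<lambda>X. - \<phi> j (\<phi> i X) + \<eta> i X *\<^sub>R \<xi> j)"
    "\<xi> k = \<phi> i (\<xi> j)" "\<xi> k = - \<phi> j (\<xi> i)"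
    "\<eta> k = \<eta> i \<circ> \<phi> j" "\<eta> k = (\<lambda>X. - \<eta> j (\<phi> i X))"
    using contact unfolding almost_3_contact_lie_algebra_def Let_def by blast+
  show "\<phi> i (\<phi> j X) = \<phi> k X + \<eta> j X *\<^sub>R \<xi> i" by (simp add: fun_cong[OF *(1)])
  show "\<phi> j (\<phi> i X) = - \<phi> k X + \<eta> i X *\<^sub>R \<xi> j" by (simp add: fun_cong[OF *(2)])
  show "\<phi> i (\<xi> j) = \<xi> k" by (simp add: *(3))
  show "\<phi> j (\<xi> i) = - \<xi> k" by (simp add: *(4))
  show "\<eta> i (\<phi> j X) = \<eta> k X" by (simp add: *(5))
  show "\<eta> j (\<phi> i X) = - \<eta> k X" by (simp add: fun_cong[OF *(6)])
qed

end

text \<open>Up to sign, \<open>\<xi> j\<close> lies in the image of \<open>\<phi> i\<close> and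
  \<open>\<xi> i\<close> in that of \<open>\<phi> j\<close>, and each form vanishes on the image of
  its own endomorphism.\<close>

lemma eta_xi:
  assumes "cyclic i j k"
  shows "\<eta> i (\<xi> j) = 0" "\<eta> j (\<xi> i) = 0"
proof -
  have c: "cyclic j k i" "cyclic k i j"
    using assms cyclic_rotate by blast+
  have "\<xi> j = - \<phi> i (\<xi> k)" by (simp add: phi_xi'[OF c(2)])
  then show "\<eta> i (\<xi> j) = 0" by simp
  have "\<xi> i = \<phi> j (\<xi> k)" by (simp add: phi_xi[OF c(1)])
  then show "\<eta> j (\<xi> i) = 0" by simp
qed

lemma eta_xi_delta: "\<eta> i (\<xi> j) = (if i = j then 1 else 0)"
\<comment> \<open>Conjoining the swapped equation makes the predicate symmetric.\<close>
proof (rule symmetric_rel_3[where P = "\<lambda>i j. \<eta> i (\<xi> j) = (if i = j then 1 else 0)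
      \<and> \<eta> j (\<xi> i) = (if i = j then 1 else 0)", THEN conjunct1])
  show "\<eta> i (\<xi> (i + 1)) = (if i = i + 1 then 1 else 0) \<and>
      \<eta> (i + 1) (\<xi> i) = (if i = i + 1 then 1 else 0)" for i
    using eta_xi[of i "i + 1" "i + 2"] by (simp add: cyclic_def)
qed auto

text \<open>Off the diagonal the terms in the third endomorphism cancel. The right side is kept as a
  term in \<open>(i, j)\<close> plus its swap, the shape that \<open>quadratic_sum_eqI\<close>
  expects.\<close>

lemma phi_polarised:
  "\<phi> i (\<phi> j X) + \<phi> j (\<phi> i X)
    = ((if i = j then - X else 0) + \<eta> j X *\<^sub>R \<xi> i) + ((if j = i then - X else 0) + \<eta> i X *\<^sub>R \<xi> j)"
proof (rule symmetric_rel_3)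
  show "\<phi> i (\<phi> (i + 1) X) + \<phi> (i + 1) (\<phi> i X)
    = ((if i = i + 1 then - X else 0) + \<eta> (i + 1) X *\<^sub>R \<xi> i)
      + ((if i + 1 = i then - X else 0) + \<eta> i X *\<^sub>R \<xi> (i + 1))" for i
    using phi_phi[of i "i + 1" "i + 2" X] phi_phi'[of i "i + 1" "i + 2" X]
    by (simp add: cyclic_def)
qed (auto simp: phi_square add.commute)

section \<open>Bracket identities forced by abelianness\<close>

lemma ad_xi_phi: "br (\<xi> i) (\<phi> i X) = \<phi> i (br (\<xi> i) X)"
  using abelian unfolding abelian_3_contact_def abelian_almost_contact_def by (metis comp_apply)

text \<open>Projecting along \<open>\<xi> i\<close> puts both arguments into the kernel of
  \<open>\<eta> i\<close>, while \<open>\<phi> i\<close> does not see the projection since it kills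
  \<open>\<xi> i\<close>.\<close>

lemma br_phi_phi:
  "br (\<phi> i X) (\<phi> i Y) = br X Y - \<eta> i X *\<^sub>R br (\<xi> i) Y + \<eta> i Y *\<^sub>R br (\<xi> i) X"
proof -
  let ?X = "X - \<eta> i X *\<^sub>R \<xi> i" and ?Y = "Y - \<eta> i Y *\<^sub>R \<xi> i"
  have "\<eta> i ?X = 0" "\<eta> i ?Y = 0"
    by simp_all
  then have "br (\<phi> i ?X) (\<phi> i ?Y) = br ?X ?Y"
    using abelian unfolding abelian_3_contact_def abelian_almost_contact_def by blast
  then show ?thesis
    by (simp add: br_skew[of X "\<xi> i"] algebra_simps)
qed

lemma br_phi:
  "br (\<phi> i X) Y = - br X (\<phi> i Y) + \<eta> i X *\<^sub>R br (\<xi> i) (\<phi> i Y) - \<eta> i Y *\<^sub>R br (\<xi> i) (\<phi> i X)"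
  using br_phi_phi[of i X "\<phi> i Y"]
  by (simp add: phi_square br_skew[of "\<phi> i X" "\<xi> i"] algebra_simps)

context
  fixes i j k
  assumes cyc: "cyclic i j k"
begin

text \<open>Inserting \<open>\<xi> i\<close> into \<open>br_phi\<close> for the structure
  \<open>j\<close> turns \<open>\<phi> j (\<xi> i)\<close> into \<open>- \<xi> k\<close>, and
  \<open>\<eta> j (\<xi> i) = 0\<close> removes one correction.\<close>

lemma ad_xi_phi_next: "br (\<xi> i) (\<phi> j X) = br (\<xi> k) X + \<eta> j X *\<^sub>R br (\<xi> j) (\<xi> k)"
  using br_phi[of j "\<xi> i" X] by (simp add: phi_xi'[OF cyc] eta_xi[OF cyc] algebra_simps)

lemma ad_xi_phi_prev: "br (\<xi> j) (\<phi> i X) = - br (\<xi> k) X - \<eta> i X *\<^sub>R br (\<xi> i) (\<xi> k)"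
proof -
  have "br (\<xi> k) X = - br (\<xi> j) (\<phi> i X) - \<eta> i X *\<^sub>R br (\<xi> i) (\<xi> k)"
    using br_phi[of i "\<xi> j" X] by (simp add: phi_xi[OF cyc] eta_xi[OF cyc])
  then show ?thesis by simp
qed

lemma phi_br_xi: "\<phi> i (br (\<xi> i) (\<xi> j)) = br (\<xi> i) (\<xi> k)"
  using ad_xi_phi[of i "\<xi> j"] by (simp add: phi_xi[OF cyc])

text \<open>Since \<open>\<phi> i\<close> commutes with \<open>br (\<xi> i)\<close> and sends
  \<open>\<xi> k\<close> to \<open>- \<xi> j\<close>, the bracket lies in the image of
  \<open>\<phi> i\<close>.\<close>

lemma eta_br_xi: "\<eta> i (br (\<xi> i) (\<xi> j)) = 0"
proof -
  have "\<phi> i (\<xi> k) = - \<xi> j"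
    using cyc by (metis cyclic_rotate phi_xi')
  then have "- br (\<xi> i) (\<xi> j) = \<phi> i (br (\<xi> i) (\<xi> k))"
    using ad_xi_phi[of i "\<xi> k"] by simp
  then have "\<eta> i (- br (\<xi> i) (\<xi> j)) = 0"
    by (simp only: eta_phi_self)
  then show ?thesis by simp
qed

end

text \<open>Applying \<open>\<phi> j\<close> to \<open>- \<phi> i (br (\<xi> i) (\<xi> j))\<close>
  produces \<open>\<phi> k\<close>; its Reeb correction vanishes by
  \<open>eta_br_xi\<close>.\<close>

lemma phi_br_xi_rotate:
  assumes cyc: "cyclic i j k"
  shows "\<phi> j (br (\<xi> k) (\<xi> i)) = \<phi> k (br (\<xi> i) (\<xi> j))"
proof -
  have "br (\<xi> k) (\<xi> i) = - \<phi> i (br (\<xi> i) (\<xi> j))"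
    by (simp add: phi_br_xi[OF cyc] br_skew[of "\<xi> k"])
  then show ?thesis
    by (simp add: phi_phi'[OF cyc] eta_br_xi[OF cyc])
qed

lemma ad_xi_phi_polarised:
  "br (\<xi> i) (\<phi> j X) + br (\<xi> j) (\<phi> i X) = \<phi> i (br (\<xi> j) X) + \<phi> j (br (\<xi> i) X)"
proof (rule symmetric_rel_3[where P = "\<lambda>i j.
      br (\<xi> i) (\<phi> j X) + br (\<xi> j) (\<phi> i X) = \<phi> i (br (\<xi> j) X) + \<phi> j (br (\<xi> i) X)"])
  fix i :: 3
  define j k where "j = i + 1" and "k = i + 2"
  have c: "cyclic i j k" "cyclic j k i" "cyclic k i j"
    by (simp_all add: cyclic_def j_def k_def)
  \<comment> \<open>Writing \<open>br (\<xi> j)\<close> through \<open>br (\<xi> i)\<close> allows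
    \<open>\<phi> i\<close> to be commuted inside.\<close>
  have "br (\<xi> j) X = - br (\<xi> i) (\<phi> k X) - \<eta> k X *\<^sub>R br (\<xi> k) (\<xi> j)"
    by (simp add: ad_xi_phi_prev[OF c(3)])
  then have "\<phi> i (br (\<xi> j) X) = - br (\<xi> i) (\<phi> i (\<phi> k X)) - \<eta> k X *\<^sub>R \<phi> i (br (\<xi> k) (\<xi> j))"
    by (simp add: ad_xi_phi)
  \<comment> \<open>The Reeb part of \<open>\<phi> i (\<phi> k X)\<close> is a multiple of
    \<open>\<xi> i\<close>, which \<open>br (\<xi> i)\<close> kills.\<close>
  then have 1: "\<phi> i (br (\<xi> j) X) = br (\<xi> i) (\<phi> j X) + \<eta> k X *\<^sub>R \<phi> i (br (\<xi> j) (\<xi> k))"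
    by (simp add: phi_phi'[OF c(3)] br_skew[of "\<xi> k"])
  have "br (\<xi> i) X = br (\<xi> j) (\<phi> k X) - \<eta> k X *\<^sub>R br (\<xi> k) (\<xi> i)"
    by (simp add: ad_xi_phi_next[OF c(2)])
  then have "\<phi> j (br (\<xi> i) X) = br (\<xi> j) (\<phi> j (\<phi> k X)) - \<eta> k X *\<^sub>R \<phi> j (br (\<xi> k) (\<xi> i))"
    by (simp add: ad_xi_phi)
  then have 2: "\<phi> j (br (\<xi> i) X) = br (\<xi> j) (\<phi> i X) - \<eta> k X *\<^sub>R \<phi> j (br (\<xi> k) (\<xi> i))"
    by (simp add: phi_phi[OF c(2)])
  \<comment> \<open>Hence the two corrections, both with coefficient \<open>\<eta> k X\<close>,
    cancel in the sum.\<close>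
  have "\<phi> i (br (\<xi> j) (\<xi> k)) = \<phi> j (br (\<xi> k) (\<xi> i))"
    using phi_br_xi_rotate[OF c(3)] by simp
  with 1 2 show "br (\<xi> i) (\<phi> (i + 1) X) + br (\<xi> (i + 1)) (\<phi> i X)
      = \<phi> i (br (\<xi> (i + 1)) X) + \<phi> (i + 1) (br (\<xi> i) X)"
    by (simp add: j_def)
qed (simp_all add: ad_xi_phi add.commute)

text \<open>Both terms are compared with \<open>br (\<xi> k) (\<phi> k X)\<close>, and the common
  correction along \<open>br (\<xi> i) (\<xi> j)\<close> drops out.\<close>

lemma ad_xi_phi_diff:
  assumes "cyclic i j k"
  shows "br (\<xi> j) (\<phi> j X) - br (\<xi> i) (\<phi> i X) = \<eta> i X *\<^sub>R br (\<xi> k) (\<xi> j) + \<eta> j X *\<^sub>R br (\<xi> k) (\<xi> i)"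
proof -
  have c: "cyclic j k i" "cyclic k i j"
    using assms cyclic_rotate by blast+
  have "br (\<xi> j) (\<phi> j X) = br (\<xi> k) (\<phi> k X) + \<eta> j X *\<^sub>R br (\<xi> k) (\<xi> i) - \<eta> k X *\<^sub>R br (\<xi> i) (\<xi> j)"
    using ad_xi_phi_next[OF c(2), of "\<phi> j X"]
    by (simp add: phi_phi[OF assms] eta_phi[OF assms] algebra_simps)
  moreover have "br (\<xi> i) (\<phi> i X)
      = br (\<xi> k) (\<phi> k X) - \<eta> i X *\<^sub>R br (\<xi> k) (\<xi> j) - \<eta> k X *\<^sub>R br (\<xi> i) (\<xi> j)"
    using ad_xi_phi_prev[OF c(1), of "\<phi> i X"]
    by (simp add: phi_phi'[OF assms] eta_phi'[OF assms] br_skew[of "\<xi> j" "\<xi> i"] algebra_simps)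
  ultimately show ?thesis by simp
qed

lemma br_phi_phi_polarised:
  "br (\<phi> i X) (\<phi> j Y) + br (\<phi> j X) (\<phi> i Y)
    = ((if i = j then br X Y else 0) - \<eta> i X *\<^sub>R br (\<xi> j) Y + \<eta> i Y *\<^sub>R br (\<xi> j) X)
      + ((if j = i then br X Y else 0) - \<eta> j X *\<^sub>R br (\<xi> i) Y + \<eta> j Y *\<^sub>R br (\<xi> i) X)"
proof (rule symmetric_rel_3[where P = "\<lambda>i j. br (\<phi> i X) (\<phi> j Y) + br (\<phi> j X) (\<phi> i Y)
    = ((if i = j then br X Y else 0) - \<eta> i X *\<^sub>R br (\<xi> j) Y + \<eta> i Y *\<^sub>R br (\<xi> j) X)
      + ((if j = i then br X Y else 0) - \<eta> j X *\<^sub>R br (\<xi> i) Y + \<eta> j Y *\<^sub>R br (\<xi> i) X)"])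
  fix i :: 3
  define j k where "j = i + 1" and "k = i + 2"
  have c: "cyclic i j k" "cyclic j k i" "cyclic k i j"
    by (simp_all add: cyclic_def j_def k_def)
  \<comment> \<open>Moving the first endomorphism onto the second argument creates
    \<open>\<phi> i (\<phi> j Y)\<close> here and \<open>\<phi> j (\<phi> i Y)\<close> in
    \<open>ji\<close>, so the terms \<open>br X (\<phi> k Y)\<close> occur with opposite
    signs.\<close>
  have ij: "br (\<phi> i X) (\<phi> j Y) = - br X (\<phi> k Y) + \<eta> j Y *\<^sub>R br (\<xi> i) X
      - \<eta> i X *\<^sub>R (br (\<xi> j) Y + \<eta> k Y *\<^sub>R br (\<xi> k) (\<xi> j)) - \<eta> k Y *\<^sub>R br (\<xi> i) (\<phi> i X)"
    using br_phi[of i X "\<phi> j Y"]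
    by (simp add: phi_phi[OF c(1)] eta_phi[OF c(1)] ad_xi_phi_prev[OF c(3)]
        br_skew[of X "\<xi> i"] algebra_simps)
  have ji: "br (\<phi> j X) (\<phi> i Y) = br X (\<phi> k Y) + \<eta> i Y *\<^sub>R br (\<xi> j) X
      - \<eta> j X *\<^sub>R (br (\<xi> i) Y + \<eta> k Y *\<^sub>R br (\<xi> k) (\<xi> i)) + \<eta> k Y *\<^sub>R br (\<xi> j) (\<phi> j X)"
    using br_phi[of j X "\<phi> i Y"]
    by (simp add: phi_phi'[OF c(1)] eta_phi'[OF c(1)] ad_xi_phi_next[OF c(2)]
        br_skew[of X "\<xi> j"] algebra_simps)
  \<comment> \<open>This says precisely that the coefficient of \<open>\<eta> k Y\<close> in the sum
    of \<open>ij\<close> and \<open>ji\<close> vanishes.\<close>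
  have "br (\<xi> j) (\<phi> j X)
      = br (\<xi> i) (\<phi> i X) + \<eta> i X *\<^sub>R br (\<xi> k) (\<xi> j) + \<eta> j X *\<^sub>R br (\<xi> k) (\<xi> i)"
    using ad_xi_phi_diff[OF c(1), of X] by (simp add: algebra_simps)
  then have "br (\<phi> i X) (\<phi> j Y) + br (\<phi> j X) (\<phi> i Y)
      = - \<eta> i X *\<^sub>R br (\<xi> j) Y + \<eta> i Y *\<^sub>R br (\<xi> j) X - \<eta> j X *\<^sub>R br (\<xi> i) Y + \<eta> j Y *\<^sub>R br (\<xi> i) X"
    unfolding ij ji by (simp add: algebra_simps)
  then show "br (\<phi> i X) (\<phi> (i + 1) Y) + br (\<phi> (i + 1) X) (\<phi> i Y)
    = ((if i = i + 1 then br X Y else 0) - \<eta> i X *\<^sub>R br (\<xi> (i + 1)) Y + \<eta> i Y *\<^sub>R br (\<xi> (i + 1)) X)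
      + ((if i + 1 = i then br X Y else 0) - \<eta> (i + 1) X *\<^sub>R br (\<xi> i) Y
         + \<eta> (i + 1) Y *\<^sub>R br (\<xi> i) X)"
    by (simp add: j_def)
qed (auto simp: br_phi_phi algebra_simps)

section \<open>Assembling the conditions over the sphere\<close>

lemma almost_contact_sphere:
  assumes a: "a \<in> sphere (0 :: real ^ 3) 1"
  shows "almost_contact (\<lambda>X. \<Sum>i\<in>UNIV. a $ i *\<^sub>R \<phi> i X) (\<Sum>i\<in>UNIV. a $ i *\<^sub>R \<xi> i)
           (\<lambda>X. \<Sum>i\<in>UNIV. a $ i * \<eta> i X)"
  unfolding almost_contact_def
proof (intro conjI ext)
  show "linear (\<lambda>X. \<Sum>i\<in>UNIV. a $ i *\<^sub>R \<phi> i X)"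
    by (intro linear_compose_sum ballI linear_compose_scale_right linear_phi)
  show "linear (\<lambda>X. \<Sum>i\<in>UNIV. a $ i * \<eta> i X)"
    using linear_compose_scale_right[OF linear_eta]
    by (intro linear_compose_sum) simp
  fix X
  have "((\<lambda>X. \<Sum>i\<in>UNIV. a $ i *\<^sub>R \<phi> i X) \<circ> (\<lambda>X. \<Sum>i\<in>UNIV. a $ i *\<^sub>R \<phi> i X)) X
      = (\<Sum>i\<in>UNIV. \<Sum>j\<in>UNIV. (a $ i * a $ j) *\<^sub>R \<phi> i (\<phi> j X))"
    by (simp add: linear_sum[OF linear_phi] scaleR_sum_right)
  also have "\<dots> = (\<Sum>i\<in>UNIV. \<Sum>j\<in>UNIV.
      (a $ i * a $ j) *\<^sub>R ((if i = j then - X else 0) + \<eta> j X *\<^sub>R \<xi> i))"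
    by (rule quadratic_sum_eqI) (rule phi_polarised)
  also have "\<dots> = - X + (\<Sum>i\<in>UNIV. \<Sum>j\<in>UNIV. (a $ i * a $ j) *\<^sub>R \<eta> j X *\<^sub>R \<xi> i)"
    unfolding scaleR_right_distrib sum.distrib sum_sphere_delta[OF a] ..
  also have "(\<Sum>i\<in>UNIV. \<Sum>j\<in>UNIV. (a $ i * a $ j) *\<^sub>R \<eta> j X *\<^sub>R \<xi> i)
      = (\<Sum>i\<in>UNIV. a $ i * \<eta> i X) *\<^sub>R (\<Sum>i\<in>UNIV. a $ i *\<^sub>R \<xi> i)"
    unfolding scaleR_sum_left scaleR_sum_right by (simp add: mult_ac)
  finally show "((\<lambda>X. \<Sum>i\<in>UNIV. a $ i *\<^sub>R \<phi> i X) \<circ> (\<lambda>X. \<Sum>i\<in>UNIV. a $ i *\<^sub>R \<phi> i X)) X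
      = - X + (\<Sum>i\<in>UNIV. a $ i * \<eta> i X) *\<^sub>R (\<Sum>i\<in>UNIV. a $ i *\<^sub>R \<xi> i)" .
next
  have "(\<Sum>i\<in>UNIV. a $ i * \<eta> i (\<Sum>j\<in>UNIV. a $ j *\<^sub>R \<xi> j))
      = (\<Sum>i\<in>UNIV. \<Sum>j\<in>UNIV. (a $ i * a $ j) *\<^sub>R (if i = j then 1 else 0 :: real))"
    by (simp add: linear_sum[OF linear_eta] eta_xi_delta sum_distrib_left mult.assoc)
  also have "\<dots> = 1"
    by (rule sum_sphere_delta[OF a])
  finally show "(\<Sum>i\<in>UNIV. a $ i * \<eta> i (\<Sum>j\<in>UNIV. a $ j *\<^sub>R \<xi> j)) = 1" .
qed

lemma abelian_almost_contact_sphere: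
  assumes a: "a \<in> sphere (0 :: real ^ 3) 1"
  shows "abelian_almost_contact br (\<lambda>X. \<Sum>i\<in>UNIV. a $ i *\<^sub>R \<phi> i X) (\<Sum>i\<in>UNIV. a $ i *\<^sub>R \<xi> i)
           (\<lambda>X. \<Sum>i\<in>UNIV. a $ i * \<eta> i X)"
proof -
  have br_sum: "br (\<Sum>i\<in>UNIV. a $ i *\<^sub>R F i) (\<Sum>j\<in>UNIV. a $ j *\<^sub>R G j)
      = (\<Sum>i\<in>UNIV. \<Sum>j\<in>UNIV. (a $ i * a $ j) *\<^sub>R br (F i) (G j))" for F G :: "3 \<Rightarrow> 'a"
    by (subst bilinear_sum[OF bilinear_br]) (simp add: sum.cartesian_product mult.commute)
  have br_sum_left: "br (\<Sum>i\<in>UNIV. a $ i *\<^sub>R F i) X = (\<Sum>i\<in>UNIV. a $ i *\<^sub>R br (F i) X)"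
    for F :: "3 \<Rightarrow> 'a" and X
    using bilinear_br by (simp add: bilinear_def linear_sum[of "\<lambda>x. br x X"])
  show ?thesis
    unfolding abelian_almost_contact_def
  proof (intro conjI ext allI impI)
    fix X
    have "(br (\<Sum>i\<in>UNIV. a $ i *\<^sub>R \<xi> i) \<circ> (\<lambda>X. \<Sum>i\<in>UNIV. a $ i *\<^sub>R \<phi> i X)) X
        = (\<Sum>i\<in>UNIV. \<Sum>j\<in>UNIV. (a $ i * a $ j) *\<^sub>R br (\<xi> i) (\<phi> j X))"
      by (simp add: br_sum)
    also have "\<dots> = (\<Sum>i\<in>UNIV. \<Sum>j\<in>UNIV. (a $ i * a $ j) *\<^sub>R \<phi> i (br (\<xi> j) X))"
      by (rule quadratic_sum_eqI) (rule ad_xi_phi_polarised)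
    also have "\<dots> = ((\<lambda>X. \<Sum>i\<in>UNIV. a $ i *\<^sub>R \<phi> i X) \<circ> br (\<Sum>i\<in>UNIV. a $ i *\<^sub>R \<xi> i)) X"
      by (simp add: br_sum_left linear_sum[OF linear_phi] scaleR_sum_right)
    finally show "(br (\<Sum>i\<in>UNIV. a $ i *\<^sub>R \<xi> i) \<circ> (\<lambda>X. \<Sum>i\<in>UNIV. a $ i *\<^sub>R \<phi> i X)) X
        = ((\<lambda>X. \<Sum>i\<in>UNIV. a $ i *\<^sub>R \<phi> i X) \<circ> br (\<Sum>i\<in>UNIV. a $ i *\<^sub>R \<xi> i)) X" .
  next
    fix X Y
    assume X: "(\<Sum>i\<in>UNIV. a $ i * \<eta> i X) = 0" and Y: "(\<Sum>i\<in>UNIV. a $ i * \<eta> i Y) = 0"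
    \<comment> \<open>Each correction sum factors through the form at \<open>a\<close>, which
      vanishes on \<open>X\<close> and \<open>Y\<close>.\<close>
    have eta_terms: "(\<Sum>i\<in>UNIV. \<Sum>j\<in>UNIV. (a $ i * a $ j) *\<^sub>R \<eta> i V *\<^sub>R br (\<xi> j) W)
        = (\<Sum>i\<in>UNIV. a $ i * \<eta> i V) *\<^sub>R (\<Sum>j\<in>UNIV. a $ j *\<^sub>R br (\<xi> j) W)" for V W
      unfolding scaleR_sum_left scaleR_sum_right by (subst sum.swap) (simp add: mult_ac)
    have "br (\<Sum>i\<in>UNIV. a $ i *\<^sub>R \<phi> i X) (\<Sum>i\<in>UNIV. a $ i *\<^sub>R \<phi> i Y)
        = (\<Sum>i\<in>UNIV. \<Sum>j\<in>UNIV. (a $ i * a $ j) *\<^sub>R br (\<phi> i X) (\<phi> j Y))"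
      by (rule br_sum)
    also have "\<dots> = (\<Sum>i\<in>UNIV. \<Sum>j\<in>UNIV. (a $ i * a $ j) *\<^sub>R
        ((if i = j then br X Y else 0) - \<eta> i X *\<^sub>R br (\<xi> j) Y + \<eta> i Y *\<^sub>R br (\<xi> j) X))"
      by (rule quadratic_sum_eqI) (rule br_phi_phi_polarised)
    also have "\<dots> = br X Y"
      unfolding scaleR_right_distrib scaleR_right_diff_distrib sum.distrib sum_subtractf
        sum_sphere_delta[OF a] eta_terms X Y by simp
    finally show "br (\<Sum>i\<in>UNIV. a $ i *\<^sub>R \<phi> i X) (\<Sum>i\<in>UNIV. a $ i *\<^sub>R \<phi> i Y) = br X Y" .
  qed
qed

end

theorem proposition4p13:
  fixes br :: "'a::real_vector \<Rightarrow> 'a \<Rightarrow> 'a"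
    and \<phi> :: "3 \<Rightarrow> 'a \<Rightarrow> 'a" and \<xi> :: "3 \<Rightarrow> 'a" and \<eta> :: "3 \<Rightarrow> 'a \<Rightarrow> real"
  assumes "almost_3_contact_lie_algebra br \<phi> \<xi> \<eta>"
    and "abelian_3_contact br \<phi> \<xi> \<eta>"
  shows "\<forall>(f, x, h) \<in> contact_sphere \<phi> \<xi> \<eta>.
           almost_contact f x h \<and> abelian_almost_contact br f x h"
proof -
  interpret abelian_3_contact_lie_algebra br \<phi> \<xi> \<eta>
    using assms by unfold_locales
  show ?thesis
    unfolding contact_sphere_def
    using almost_contact_sphere abelian_almost_contact_sphere by auto
qed

end
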